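(* Let $\{X_n\}_{n=1}^\infty$ be IID random variables with $P(X_n=k)=\frac{C_k}{2\cdot4^k}$, $k=0,1,2,\dots$, where $C_k=\frac{1}{k+1}\binom{2k}{k}$ is the $k$th Catalan number, and let $T_n^X=\sum_{j=1}^nX_j$. Then, as $n\to\infty$, $\frac{T_n^X}{n^2}$ converges in distribution to $Z$, where $Z$ is the one-sided stable distribution with stability parameter $\frac12$ and characteristic function $$\phi(t)=E e^{-itZ}=\exp\Big(-\frac{\sqrt2}{2}\,|t|^{\frac12}\big(1+i\,\mathrm{sgn}(t)\big)\Big),\quad t\in\mathbb{R}.$$
   Context: The characteristic function is taken with the sign convention $\phi(t)=Ee^{-itZ}$. $\mathrm{sgn}(t)$ is the sign of $t$. *)

theory Defs
  imports "HOL-Probability.Probability"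
begin

definition catalan :: "nat \<Rightarrow> real" where
  "catalan k = real ((2 * k) choose k) / real (k + 1)"

(* Characteristic function with the sign convention E exp(-itZ); the library constant
   char uses E exp(itZ) instead. *)
definition char_neg :: "real measure \<Rightarrow> real \<Rightarrow> complex" where
  "char_neg \<mu> t = (CLINT x|\<mu>. exp (- (\<i> * complex_of_real t * complex_of_real x)))"

lemma char_neg_eq_char: "char_neg \<mu> t = char \<mu> (- t)"
  by (simp add: char_neg_def char_def mult.assoc)

(* For independent copies Z1, Z2 of Z and all a, b > 0, the variable a Z1 + b Z2 has the same
   law as c Z + d with c^alpha = a^alpha + b^alpha and some real shift d. Degenerate laws are
   excluded. *)
definition stable_distribution :: "real \<Rightarrow> real measure \<Rightarrow> bool" where
  "stable_distribution \<alpha> \<mu> \<longleftrightarrow>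
     real_distribution \<mu> \<and> 0 < \<alpha> \<and> \<alpha> \<le> 2 \<and>
     \<not> (\<exists>c. AE x in \<mu>. x = c) \<and>
     (\<forall>a>0. \<forall>b>0. \<exists>c>0. \<exists>d. c powr \<alpha> = a powr \<alpha> + b powr \<alpha> \<and>
        distr (\<mu> \<Otimes>\<^sub>M \<mu>) borel (\<lambda>(x, y). a * x + b * y) =
        distr \<mu> borel (\<lambda>x. c * x + d))"

definition one_sided_stable :: "real \<Rightarrow> real measure \<Rightarrow> bool" where
  "one_sided_stable \<alpha> \<mu> \<longleftrightarrow> stable_distribution \<alpha> \<mu> \<and> (AE x in \<mu>. 0 \<le> x)"

end

theory Submission
  imports Defs
begin

text \<open>The generating function of the step distribution is \<open>1 / (1 + csqrt (1 - z))\<close> on the closed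
  unit disc, so that \<open>E exp (c T\<^sub>n / n\<^sup>2) = (1 + csqrt (1 - exp (c / n\<^sup>2))) ^ (-n)\<close> whenever
  \<open>Re c \<le> 0\<close>. For \<open>c = \<i> t\<close> this tends to \<open>exp (- csqrt (- \<i> t))\<close>; for \<open>c = - r\<close> it is at least
  \<open>exp (- sqrt r)\<close> for every \<open>n\<close>, which gives tightness. Hence the limit law exists as a
  subsequential limit, with no need for its density, and Levy's continuity theorem gives
  convergence of the full sequence. Stability with \<open>c = (sqrt a + sqrt b)\<^sup>2\<close> and zero shift is read
  off the characteristic function, and nonnegativity passes to the weak limit.\<close>

section \<open>Catalan numbers and the binomial series of the square root\<close>

lemma catalan_Suc: "catalan (Suc k) * real (k + 2) = catalan k * (2 * real (2 * k + 1))"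
proof -
  \<comment> \<open>The absorption identity \<open>Suc_times_binomial\<close> is used twice, with
    the symmetry of \<open>2 * k + 1 choose k\<close> in between.\<close>
  have "Suc k * (2 * Suc k choose Suc k) = 2 * (2 * k + 1) * (2 * k choose k)"
  proof -
    have "2 * Suc k = Suc (2 * k + 1)" by simp
    then have "Suc k * (2 * Suc k choose Suc k) = (2 * Suc k) * (2 * k + 1 choose k)"
      by (metis Suc_times_binomial)
    also have "(2 * k + 1 choose k) = (Suc (2 * k) choose Suc k)"
      using binomial_symmetric[of k "2 * k + 1"] by simp
    also have "2 * Suc k * (Suc (2 * k) choose Suc k) = 2 * (Suc k * (Suc (2 * k) choose Suc k))"
      by simp
    finally show ?thesis
      unfolding Suc_times_binomial by simp
  qed
  then have "real (Suc k) * real (2 * Suc k choose Suc k) = 2 * real (2 * k + 1) * real (2 * k choose k)"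
    by (metis (mono_tags) of_nat_mult of_nat_numeral)
  moreover have "real (2 * j choose j) = catalan j * real (Suc j)" for j
    by (simp add: catalan_def)
  ultimately have "real (Suc k) * (catalan (Suc k) * real (Suc (Suc k)))
      = real (Suc k) * (catalan k * (2 * real (2 * k + 1)))"
    by (metis (no_types, lifting) mult.assoc mult.commute)
  then show ?thesis
    by (metis add_2_eq_Suc' mult_cancel_left of_nat_eq_0_iff nat.distinct(1))
qed

text \<open>The right-hand sides are the Taylor coefficients of
  \<open>(1 - csqrt (1 - z)) / z\<close>. Both sides start at 1/2 and obey the same recurrence, with
  factor \<open>(2 * k + 1) / (2 * (k + 2))\<close>.\<close>

lemma catalan_eq_gbinomial_half:
  "catalan k / (2 * 4 ^ k) = (- 1) ^ k * ((1 / 2 :: real) gchoose Suc k)"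
proof (induction k)
  case 0
  show ?case by (simp add: catalan_def)
next
  case (Suc k)
  have "catalan (Suc k) = catalan k * (2 * real (2 * k + 1)) / real (k + 2)"
    using catalan_Suc[of k] by (simp add: field_simps)
  then have "catalan (Suc k) / (2 * 4 ^ Suc k)
      = (catalan k / (2 * 4 ^ k)) * (real (2 * k + 1) / (2 * real (k + 2)))"
  proof -
    have "a * (2 * b) / c / (2 * (4 * q)) = (a / (2 * q)) * (b / (2 * c))" for a b c q :: real
      by simp
    then show ?thesis
      unfolding \<open>catalan (Suc k) = _\<close> power_Suc .
  qed
  moreover have "((1 / 2 :: real) gchoose Suc (Suc k)) * real (k + 2)
      = ((1 / 2) gchoose Suc k) * (1 / 2 - real (Suc k))"
    using gbinomial_mult_1[of "1 / 2 :: real" "Suc k"] by (simp add: algebra_simps)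
  then have "((1 / 2 :: real) gchoose Suc (Suc k))
      = - (((1 / 2) gchoose Suc k) * (real (2 * k + 1) / (2 * real (k + 2))))"
    by (simp add: field_simps)
  ultimately show ?case
    by (simp add: Suc.IH)
qed

lemma catalan_nonneg: "0 \<le> catalan k"
  by (simp add: catalan_def)

text \<open>An alternating partial sum of the binomial coefficients of 1/2 has the closed form
  \<open>pochhammer (1 / 2) n / fact n\<close>, which is nonnegative; so the partial sums of the
  weights never exceed 1. This bound suffices for the generating function, whose value at 1 later
  shows that the total is exactly 1.\<close>

lemma summable_catalan: "summable (\<lambda>k. catalan k / (2 * 4 ^ k))"
  and suminf_catalan_le_1: "(\<Sum>k. catalan k / (2 * 4 ^ k)) \<le> 1"
proof -
  have bound: "(\<Sum>k<n. catalan k / (2 * 4 ^ k)) \<le> 1" for n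
  proof -
    \<comment> \<open>The term with index 0 is 1; the term with index \<open>Suc k\<close> is minus
      the weight of \<open>k\<close>.\<close>
    have "(\<Sum>k\<le>n. ((1 / 2 :: real) gchoose k) * (- 1) ^ k)
        = 1 - (\<Sum>k<n. catalan k / (2 * 4 ^ k))"
      by (simp add: sum.atMost_shift catalan_eq_gbinomial_half mult.commute sum_negf)
    moreover have "(\<Sum>k\<le>n. ((1 / 2 :: real) gchoose k) * (- 1) ^ k) = pochhammer (1 / 2) n / fact n"
      unfolding gbinomial_sum_lower_neg by (simp add: gbinomial_pochhammer power_mult_distrib[symmetric])
    moreover have "0 \<le> pochhammer (1 / 2 :: real) n / fact n"
      by (intro divide_nonneg_nonneg pochhammer_nonneg) auto
    ultimately show ?thesis by linarith
  qed
  show *: "summable (\<lambda>k. catalan k / (2 * 4 ^ k))"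
    using bound by (intro summableI_nonneg_bounded[where x = 1]) (auto simp: catalan_nonneg)
  show "(\<Sum>k. catalan k / (2 * 4 ^ k)) \<le> 1"
    using bound * by (intro suminf_le_const) auto
qed

text \<open>For the binomial series \<open>S\<close> of the square root of \<open>1 - z\<close>, Vandermonde's identity
  gives \<open>S\<^sup>2 = 1 - z\<close> on the closed disc, and \<open>Re S \<ge> 0\<close> because the weights sum to at most
  1; this selects the principal root without an appeal to Abel's theorem.\<close>
lemma catalan_generating_function:
  fixes z :: complex
  assumes z: "norm z \<le> 1"
  shows "(\<lambda>k. complex_of_real (catalan k / (2 * 4 ^ k)) * z ^ k) sums (1 / (1 + csqrt (1 - z)))"
proof (cases "z = 0")
  \<comment> \<open>The point 0 is treated apart because the general case ends with a division by
    \<open>z\<close>.\<close>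
  case True
  then show ?thesis
    using powser_sums_zero[of "\<lambda>k. complex_of_real (catalan k / (2 * 4 ^ k))"]
    by (simp add: catalan_def)
next
  case False
  define p where "p k = catalan k / (2 * 4 ^ k)" for k
  define f where "f = (\<Sum>k. complex_of_real (p k) * z ^ k)"
  \<comment> \<open>The terms of the series called \<open>S\<close> above. Beyond the zeroth they
    are \<open>- z\<close> times those of \<open>f\<close>, so the sum is
    \<open>1 - z * f\<close>.\<close>
  define A where "A k = complex_of_real ((- 1) ^ k * ((1 / 2) gchoose k)) * z ^ k" for k
  have p: "0 \<le> p k" "summable p" "suminf p \<le> 1" for k
    using summable_catalan suminf_catalan_le_1 by (auto simp: p_def[abs_def] catalan_nonneg)
  have le: "norm (complex_of_real (p k) * z ^ k) \<le> p k" for k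
    using p(1)[of k] power_le_one[OF norm_ge_zero z, of k]
    by (simp add: norm_mult norm_power mult_left_le)
  have sn: "summable (\<lambda>k. norm (complex_of_real (p k) * z ^ k))"
    by (rule summable_comparison_test[OF _ p(2)]) (use le in auto)
  have f: "(\<lambda>k. complex_of_real (p k) * z ^ k) sums f"
    unfolding f_def using summable_norm_cancel[OF sn] by (rule summable_sums)
  have "norm f \<le> (\<Sum>k. norm (complex_of_real (p k) * z ^ k))"
    unfolding f_def by (rule summable_norm[OF sn])
  also have "\<dots> \<le> suminf p"
    by (rule suminf_le[OF le sn p(2)])
  finally have norm_f: "norm f \<le> 1"
    using p(3) by linarith
  have A_Suc: "A (Suc k) = - z * (complex_of_real (p k) * z ^ k)" for k
    by (simp add: A_def p_def catalan_eq_gbinomial_half)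
  have "(\<lambda>k. A (Suc k)) sums (- z * f)"
    unfolding A_Suc by (rule sums_mult[OF f])
  then have A_sums: "A sums (1 - z * f)"
    using sums_Suc[of A "- z * f"] by (simp add: A_def)
  have A_norm: "summable (\<lambda>k. norm (A k))"
    by (subst summable_Suc_iff[symmetric]) (simp only: A_Suc norm_mult[of "- z"] summable_mult[OF sn])
  have "(\<Sum>i\<le>k. A i * A (k - i)) = complex_of_real ((- 1) ^ k * (1 gchoose k)) * z ^ k" for k
  proof -
    have "(\<Sum>i\<le>k. A i * A (k - i))
        = complex_of_real (\<Sum>i\<le>k. (- 1) ^ k * (((1 / 2) gchoose i) * ((1 / 2) gchoose (k - i)))) * z ^ k"
      unfolding of_real_sum sum_distrib_right
    proof (rule sum.cong[OF refl])
      fix i assume "i \<in> {..k}"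
      then have "i + (k - i) = k" by simp
      then have "(-1) ^ k = (-1 :: real) ^ i * (-1) ^ (k - i)" "z ^ k = z ^ i * z ^ (k - i)"
        by (metis power_add)+
      then show "A i * A (k - i)
          = complex_of_real ((- 1) ^ k * (((1 / 2) gchoose i) * ((1 / 2) gchoose (k - i)))) * z ^ k"
        by (simp add: A_def)
    qed
    also have "(\<Sum>i\<le>k. (- 1) ^ k * (((1 / 2 :: real) gchoose i) * ((1 / 2) gchoose (k - i))))
        = (- 1) ^ k * (1 gchoose k)"
      using gbinomial_Vandermonde[of "1 / 2 :: real" "1 / 2" k]
      by (simp add: sum_distrib_left[symmetric] atMost_atLeast0)
    finally show ?thesis .
  qed
  then have conv: "(\<lambda>k. complex_of_real ((- 1) ^ k * (1 gchoose k)) * z ^ k) sums ((1 - z * f) * (1 - z * f))"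
    using Cauchy_product_sums[OF A_norm A_norm] sums_unique[OF A_sums] by simp
  \<comment> \<open>Only the indices 0 and 1 survive in the Cauchy product, which leaves
    \<open>1 - z\<close>.\<close>
  have "(1 gchoose k) = (0 :: real)" if "k \<notin> {0, 1}" for k
    using that gbinomial_binomial[of 1 k] binomial_gbinomial[of 1 k, where 'a = real]
    by (simp add: binomial_eq_0)
  then have "(\<lambda>k. complex_of_real ((- 1) ^ k * (1 gchoose k)) * z ^ k) sums (1 - z)"
    using sums_finite[of "{0, 1}" "\<lambda>k. complex_of_real ((- 1) ^ k * (1 gchoose k)) * z ^ k"]
    by simp
  with conv have sq: "(1 - z * f)\<^sup>2 = 1 - z"
    unfolding power2_eq_square by (rule sums_unique2)
  have Re: "0 \<le> Re (1 - z * f)"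
    using complex_Re_le_cmod[of "z * f"] mult_le_one[OF z norm_ge_zero norm_f]
    by (simp add: norm_mult)
  define w where "w = csqrt (1 - z)"
  have "1 - z * f = w"
  proof (cases "0 < Re (1 - z * f)")
    case True
    then show ?thesis
      unfolding w_def using sq by (intro csqrt_unique[symmetric]) auto
  next
    case False
    \<comment> \<open>On the imaginary axis the square has nonpositive real part, while
      \<open>1 - z\<close> has nonnegative real part; hence both roots are 0.\<close>
    with Re have "Re (1 - z * f) = 0" by simp
    then have "Re ((1 - z * f)\<^sup>2) = - (Im (1 - z * f))\<^sup>2"
      by (simp add: Re_power2)
    moreover have "0 \<le> Re (1 - z)"
      using complex_Re_le_cmod[of z] z by simp
    ultimately have "Im (1 - z * f) = 0"
      unfolding sq by (metis neg_0_le_iff_le power2_less_eq_zero_iff)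
    with \<open>Re (1 - z * f) = 0\<close> have "1 - z * f = 0" by (simp add: complex_eq_iff)
    with sq show ?thesis by (simp add: w_def)
  qed
  \<comment> \<open>Rationalises \<open>f = (1 - w) / z\<close> to \<open>1 / (1 + w)\<close>, using
    that the square of \<open>w\<close> is \<open>1 - z\<close>.\<close>
  then have "z * (f * (1 + w)) = (1 - w) * (1 + w)"
    by (metis add_diff_cancel_left' diff_add_cancel diff_diff_eq2 mult.assoc)
  also have "\<dots> = 1 - w\<^sup>2"
    by (simp add: algebra_simps power2_eq_square)
  also have "\<dots> = z * 1"
    by (simp add: w_def)
  finally have "z * (f * (1 + w)) = z * 1" .
  with False have "f * (1 + w) = 1" by simp
  then have "f = 1 / (1 + w)"
    by (metis divide_divide_eq_right div_by_1 eq_divide_imp mult_zero_right zero_neq_one)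
  with f show ?thesis by (simp add: p_def w_def)
qed

section \<open>The principal square root and limits of powers\<close>

text \<open>A nonnegative factor \<open>sqrt a\<close> keeps the root in the principal half-plane.
  This serves both to move \<open>n\<close> under the root and to verify stability.\<close>

lemma csqrt_of_real_mult:
  assumes "0 \<le> a"
  shows "csqrt (complex_of_real a * z) = complex_of_real (sqrt a) * csqrt z"
proof (rule csqrt_unique)
  show "(complex_of_real (sqrt a) * csqrt z)\<^sup>2 = complex_of_real a * z"
    using assms by (simp add: power_mult_distrib flip: of_real_power)
  show "0 < Re (complex_of_real (sqrt a) * csqrt z) \<or>
      Re (complex_of_real (sqrt a) * csqrt z) = 0 \<and> 0 \<le> Im (complex_of_real (sqrt a) * csqrt z)"
    using assms csqrt_principal[of z] by (cases "a = 0") auto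
qed

text \<open>The bridge from the \<open>csqrt\<close> form used throughout to the exponent in the
  theorem. For \<open>t \<noteq> 0\<close> the square of \<open>1 + \<i> * sgn t\<close> is
  \<open>2 * \<i> * sgn t\<close>, and the positive real part selects the principal root.\<close>

lemma csqrt_imaginary:
  "csqrt (\<i> * complex_of_real t)
    = complex_of_real (sqrt 2 / 2) * complex_of_real (\<bar>t\<bar> powr (1 / 2)) * (1 + \<i> * complex_of_real (sgn t))"
proof (rule csqrt_unique)
  have "(\<bar>t\<bar> powr (1 / 2))\<^sup>2 = \<bar>t\<bar>"
    by (simp add: powr_half_sqrt)
  then have "(complex_of_real (\<bar>t\<bar> powr (1 / 2)))\<^sup>2 = complex_of_real \<bar>t\<bar>"
    by (metis of_real_power)
  moreover have "(complex_of_real (sqrt 2 / 2))\<^sup>2 = 1 / 2"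
    by (simp add: power_divide flip: of_real_power)
  moreover have "complex_of_real \<bar>t\<bar> * (1 + \<i> * complex_of_real (sgn t))\<^sup>2 = 2 * (\<i> * complex_of_real t)"
    by (cases "t = 0") (auto simp: power2_eq_square algebra_simps sgn_if complex_eq_iff abs_if)
  ultimately show "(complex_of_real (sqrt 2 / 2) * complex_of_real (\<bar>t\<bar> powr (1 / 2))
      * (1 + \<i> * complex_of_real (sgn t)))\<^sup>2 = \<i> * complex_of_real t"
    by (simp only: power_mult_distrib mult.assoc) simp
qed (cases "t = 0"; simp)

text \<open>Nonnegative real parts put \<open>1 / (1 + w n)\<close> and \<open>exp (- w n)\<close>
  in the closed unit disc, where \<open>n\<close>-th powers differ by at most \<open>n\<close> times
  the difference of the bases. The two functions agree to first order at 0, so this bound is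
  \<open>n * w n\<close> times a factor tending to 0.\<close>

lemma tendsto_inverse_one_plus_power:
  fixes w :: "nat \<Rightarrow> complex"
  assumes lim: "(\<lambda>n. of_nat n * w n) \<longlonglongrightarrow> L" and Re: "\<And>n. 0 \<le> Re (w n)"
  shows "(\<lambda>n. (1 / (1 + w n)) ^ n) \<longlonglongrightarrow> exp (- L)"
proof -
  define g where "g z = 1 / (1 + z) - exp (- z)" for z :: complex
  have "(g has_field_derivative 0) (at 0)"
    unfolding g_def by (auto intro!: derivative_eq_intros)
  \<comment> \<open>Caratheodory's form of the derivative: \<open>h\<close> is continuous at 0 and
    takes there the value of the derivative, which is 0.\<close>
  then obtain h where h: "\<And>z. g z = h z * z" "isCont h 0" "h 0 = 0"
    unfolding CARAT_DERIV by (auto simp: g_def)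
  have "(\<lambda>n. of_nat n * w n * inverse (of_nat n)) \<longlonglongrightarrow> L * 0"
    by (intro tendsto_mult lim lim_inverse_n)
  moreover have "\<forall>\<^sub>F n in sequentially. of_nat n * w n * inverse (of_nat n) = w n"
    using eventually_gt_at_top[of 0] by eventually_elim simp
  ultimately have w: "w \<longlonglongrightarrow> 0"
    by (simp add: Lim_transform_eventually)
  have "(\<lambda>n. norm (of_nat n * w n) * norm (h (w n))) \<longlonglongrightarrow> norm L * norm (h 0)"
    by (intro tendsto_mult tendsto_norm lim isCont_tendsto_compose[OF h(2) w])
  then have bound: "(\<lambda>n. norm (of_nat n * w n) * norm (h (w n))) \<longlonglongrightarrow> 0"
    by (simp add: h(3))
  have "norm ((1 / (1 + w n)) ^ n - exp (- w n) ^ n) \<le> norm (of_nat n * w n) * norm (h (w n))" for n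
  proof -
    have "1 \<le> norm (1 + w n)"
      using complex_Re_le_cmod[of "1 + w n"] Re[of n] by simp
    then have "norm (1 / (1 + w n)) \<le> 1"
      by (simp add: norm_divide divide_le_eq)
    moreover have "norm (exp (- w n)) \<le> 1"
      using Re[of n] by simp
    ultimately have "norm ((1 / (1 + w n)) ^ n - exp (- w n) ^ n) \<le> n * norm (g (w n))"
      unfolding g_def by (rule norm_power_diff)
    then show ?thesis
      by (simp add: h(1) norm_mult mult_ac)
  qed
  then have "(\<lambda>n. (1 / (1 + w n)) ^ n - exp (- w n) ^ n) \<longlonglongrightarrow> 0"
    by (intro Lim_null_comparison[OF _ bound]) auto
  moreover have "(\<lambda>n. exp (- w n) ^ n) \<longlonglongrightarrow> exp (- L)"
    using tendsto_exp[OF tendsto_minus[OF lim]] by (simp flip: exp_of_nat_mult)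
  ultimately show ?thesis
    by (rule Lim_transform[rotated])
qed

text \<open>Under the root the factor becomes \<open>n\<^sup>2\<close>, and the difference quotient
  of \<open>exp\<close> at 0 yields the limit \<open>- c\<close>. The hypothesis keeps
  \<open>- c\<close> off the branch cut, so \<open>csqrt\<close> is continuous there.\<close>

lemma tendsto_scaled_csqrt:
  fixes c :: complex
  assumes c: "- c \<notin> \<real>\<^sub>\<le>\<^sub>0"
  shows "(\<lambda>n. of_nat n * csqrt (1 - exp (c / (of_nat n)\<^sup>2))) \<longlonglongrightarrow> csqrt (- c)"
proof -
  have "c \<noteq> 0" using c by auto
  have "(\<lambda>n. c * inverse (of_nat n) * inverse (of_nat n :: complex)) \<longlonglongrightarrow> c * 0 * 0"
    by (intro tendsto_intros lim_inverse_n)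
  then have h: "(\<lambda>n. c / (of_nat n)\<^sup>2) \<longlonglongrightarrow> 0"
    by (simp add: power2_eq_square divide_simps)
  moreover have "\<forall>\<^sub>F n in sequentially. c / (of_nat n)\<^sup>2 \<noteq> 0"
    using eventually_gt_at_top[of 0] by eventually_elim (simp add: \<open>c \<noteq> 0\<close>)
  ultimately have "filterlim (\<lambda>n. c / (of_nat n)\<^sup>2) (at 0) sequentially"
    by (simp add: filterlim_at)
  then have "(\<lambda>n. (exp (c / (of_nat n)\<^sup>2) - 1) / (c / (of_nat n)\<^sup>2)) \<longlonglongrightarrow> 1"
    by (rule filterlim_compose[OF lim_exp_minus_1])
  then have "(\<lambda>n. - c * ((exp (c / (of_nat n)\<^sup>2) - 1) / (c / (of_nat n)\<^sup>2))) \<longlonglongrightarrow> - c * 1"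
    by (intro tendsto_intros)
  moreover have "- c * ((exp (c / (of_nat n)\<^sup>2) - 1) / (c / (of_nat n)\<^sup>2))
      = (of_nat n)\<^sup>2 * (1 - exp (c / (of_nat n)\<^sup>2))" for n :: nat
    using \<open>c \<noteq> 0\<close> by (simp add: field_simps)
  ultimately have "(\<lambda>n. (of_nat n)\<^sup>2 * (1 - exp (c / (of_nat n)\<^sup>2))) \<longlonglongrightarrow> - c"
    by simp
  then have "(\<lambda>n. csqrt ((of_nat n)\<^sup>2 * (1 - exp (c / (of_nat n)\<^sup>2)))) \<longlonglongrightarrow> csqrt (- c)"
    by (rule isCont_tendsto_compose[OF continuous_at_csqrt[OF c]])
  moreover have "csqrt ((of_nat n)\<^sup>2 * z) = of_nat n * csqrt z" for n z
    using csqrt_of_real_mult[of "(real n)\<^sup>2" z] by simp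
  ultimately show ?thesis by simp
qed

section \<open>Expectations for variables with natural values\<close>

text \<open>The events \<open>X \<omega> = real k\<close> are disjoint and their probabilities add
  up to 1, so almost every outcome lies in one of them. The expectation can then be summed over
  these events.\<close>

lemma (in prob_space)
  fixes X :: "'a \<Rightarrow> real" and g :: "real \<Rightarrow> 'b :: {banach, second_countable_topology}"
  assumes [measurable]: "X \<in> borel_measurable M"
    and total: "(\<lambda>k. prob {\<omega> \<in> space M. X \<omega> = real k}) sums 1"
  shows AE_nat_valued: "AE \<omega> in M. X \<omega> \<in> \<nat>"
    and sums_expectation_nat_valued:
      "\<lbrakk>g \<in> borel_measurable borel; \<And>k. norm (g (real k)) \<le> B\<rbrakk> \<Longrightarrow>
        (\<lambda>k. prob {\<omega> \<in> space M. X \<omega> = real k} *\<^sub>R g (real k)) sums expectation (\<lambda>\<omega>. g (X \<omega>))"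
proof -
  define A where "A k = {\<omega> \<in> space M. X \<omega> = real k}" for k
  have [measurable]: "A k \<in> events" for k
    unfolding A_def by measurable
  have "(\<lambda>k. prob (A k)) sums prob (\<Union>k. A k)"
    by (rule finite_measure_UNION) (auto simp: disjoint_family_on_def A_def)
  with total have "prob (\<Union>k. A k) = 1"
    unfolding A_def by (rule sums_unique2[symmetric])
  then have AE: "AE \<omega> in M. \<omega> \<in> (\<Union>k. A k)"
    by (rule AE_prob_1)
  then show "AE \<omega> in M. X \<omega> \<in> \<nat>"
    by eventually_elim (auto simp: A_def)
  assume [measurable]: "g \<in> borel_measurable borel" and B: "\<And>k. norm (g (real k)) \<le> B"
  define f where "f k \<omega> = indicator (A k) \<omega> *\<^sub>R g (real k)" for k \<omega>
  have single: "(\<lambda>k. f k \<omega>) sums g (X \<omega>)" "summable (\<lambda>k. norm (f k \<omega>))" if "\<omega> \<in> A j" for \<omega> j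
  proof -
    have *: "f k \<omega> = (if k = j then g (X \<omega>) else 0)" for k
      using that by (auto simp: f_def A_def indicator_def)
    show "(\<lambda>k. f k \<omega>) sums g (X \<omega>)"
      unfolding * by (rule sums_single)
    have "norm (f k \<omega>) = (if k = j then norm (g (X \<omega>)) else 0)" for k
      by (simp add: *)
    then show "summable (\<lambda>k. norm (f k \<omega>))"
      using sums_summable[OF sums_single] by simp
  qed
  have "(\<lambda>k. expectation (f k)) sums expectation (\<lambda>\<omega>. \<Sum>k. f k \<omega>)"
  proof (rule sums_integral)
    show "integrable M (f k)" for k
      unfolding f_def by (intro integrable_scaleR_left) (auto simp: emeasure_eq_measure)
    show "AE \<omega> in M. summable (\<lambda>k. norm (f k \<omega>))"
      using AE by eventually_elim (auto intro: single)
    \<comment> \<open>Domination by \<open>B\<close> times the point probabilities justifies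
      exchanging sum and expectation.\<close>
    have le: "norm (expectation (\<lambda>\<omega>. norm (f k \<omega>))) \<le> prob (A k) * B" for k
      using B[of k] by (simp add: f_def mult_left_mono)
    have "summable (\<lambda>k. prob (A k) * B)"
      using total unfolding A_def by (intro summable_mult2) (auto simp: sums_iff)
    then show "summable (\<lambda>k. expectation (\<lambda>\<omega>. norm (f k \<omega>)))"
      by (rule summable_comparison_test') (rule le)
  qed
  moreover have "expectation (f k) = prob (A k) *\<^sub>R g (real k)" for k
    unfolding f_def by (simp add: emeasure_eq_measure)
  moreover have "expectation (\<lambda>\<omega>. \<Sum>k. f k \<omega>) = expectation (\<lambda>\<omega>. g (X \<omega>))"
  proof (rule integral_cong_AE)
    show "AE \<omega> in M. (\<Sum>k. f k \<omega>) = g (X \<omega>)"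
      using AE by eventually_elim (blast intro: single sums_unique[symmetric])
    show "(\<lambda>\<omega>. \<Sum>k. f k \<omega>) \<in> borel_measurable M"
      unfolding f_def by measurable
  qed measurable
  ultimately show "(\<lambda>k. prob {\<omega> \<in> space M. X \<omega> = real k} *\<^sub>R g (real k)) sums expectation (\<lambda>\<omega>. g (X \<omega>))"
    by (simp add: A_def)
qed

section \<open>Transforms of the rescaled sums\<close>

locale iid_catalan = prob_space M for M :: "'a measure" +
  fixes X :: "nat \<Rightarrow> 'a \<Rightarrow> real"
  assumes indep: "indep_vars (\<lambda>_. borel) X {1..}"
    and distribution: "n \<ge> 1 \<Longrightarrow> prob {\<omega> \<in> space M. X n \<omega> = real k} = catalan k / (2 * 4 ^ k)"
begin

definition Y :: "nat \<Rightarrow> 'a \<Rightarrow> real" where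
  "Y n \<omega> = (\<Sum>j=1..n. X j \<omega>) / (real n)\<^sup>2"

definition \<mu> :: "nat \<Rightarrow> real measure" where
  "\<mu> n = distr M borel (Y n)"

lemma X_measurable: "n \<ge> 1 \<Longrightarrow> X n \<in> borel_measurable M"
  using indep by (auto simp: indep_vars_def)

lemma Y_measurable [measurable]: "Y n \<in> borel_measurable M"
  unfolding Y_def by (intro borel_measurable_divide borel_measurable_sum X_measurable) auto

lemma real_distribution_\<mu>: "real_distribution (\<mu> n)"
  unfolding \<mu>_def by (rule real_distribution_distr) simp

text \<open>At \<open>z = 1\<close> the root vanishes and the generating function equals 1.\<close>

lemma total_probability: "n \<ge> 1 \<Longrightarrow> (\<lambda>k. prob {\<omega> \<in> space M. X n \<omega> = real k}) sums 1"
  using catalan_generating_function[of 1]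
    sums_of_real_iff[of "\<lambda>k. catalan k / (2 * 4 ^ k)" 1, where 'a = complex]
  by (simp add: distribution)

text \<open>The hypotheses fix only point probabilities, so nonnegativity is available only almost
  everywhere.\<close>

lemma AE_Y_nonneg: "AE \<omega> in M. 0 \<le> Y n \<omega>"
proof -
  have "AE \<omega> in M. \<forall>j\<in>{1..n}. X j \<omega> \<in> \<nat>"
    by (intro AE_finite_allI AE_nat_valued X_measurable total_probability) auto
  then show ?thesis
    proof eventually_elim
    fix \<omega> assume "\<forall>j\<in>{1..n}. X j \<omega> \<in> \<nat>"
    then have "0 \<le> X j \<omega>" if "j \<in> {1..n}" for j
      using that by (metis Nats_cases of_nat_0_le_iff)
    then show "0 \<le> Y n \<omega>"
      unfolding Y_def by (intro divide_nonneg_nonneg sum_nonneg) auto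
  qed
qed

lemma expectation_exp_X:
  assumes "n \<ge> 1" "Re c \<le> 0"
  shows "expectation (\<lambda>\<omega>. exp (c * complex_of_real (X n \<omega>))) = 1 / (1 + csqrt (1 - exp c))"
proof -
  have bound: "norm (exp (c * complex_of_real (real k))) \<le> 1" for k
    using assms by (simp add: mult_nonpos_nonneg)
  have "(\<lambda>k. prob {\<omega> \<in> space M. X n \<omega> = real k} *\<^sub>R exp (c * complex_of_real (real k)))
      sums expectation (\<lambda>\<omega>. exp (c * complex_of_real (X n \<omega>)))"
    using assms
    by (intro sums_expectation_nat_valued[where g = "\<lambda>x. exp (c * complex_of_real x)" and B = 1]
        X_measurable total_probability bound) auto
  moreover have "prob {\<omega> \<in> space M. X n \<omega> = real k} *\<^sub>R exp (c * complex_of_real (real k))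
      = complex_of_real (catalan k / (2 * 4 ^ k)) * exp c ^ k" for k
    using assms by (simp add: distribution scaleR_conv_of_real exp_of_nat_mult mult.commute[of c])
  ultimately show ?thesis
    using catalan_generating_function[of "exp c"] assms by (simp add: sums_unique2)
qed

text \<open>By independence the transform of the sum is the \<open>n\<close>-th power of the
  one-step transform at \<open>c / n\<^sup>2\<close>. For \<open>n = 0\<close> both sides are 1,
  since division by 0 makes \<open>Y 0\<close> zero.\<close>

lemma expectation_exp_Y:
  assumes "Re c \<le> 0"
  shows "expectation (\<lambda>\<omega>. exp (c * complex_of_real (Y n \<omega>)))
    = (1 / (1 + csqrt (1 - exp (c / (of_nat n)\<^sup>2)))) ^ n"
proof -
  define d where "d = c / (of_nat n)\<^sup>2"
  have "Re d \<le> 0"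
    using assms by (simp add: d_def Re_divide_of_nat[of c "n ^ 2", simplified] divide_nonpos_nonneg)
  have indep': "indep_vars (\<lambda>_. borel) (\<lambda>j \<omega>. exp (d * complex_of_real (X j \<omega>))) {1..n}"
    by (rule indep_vars_compose2[OF indep_vars_subset[OF indep]]) auto
  have "integrable M (\<lambda>\<omega>. exp (d * complex_of_real (X j \<omega>)))" if "j \<in> {1..n}" for j
  proof (rule integrable_const_bound[where B = 1])
    have "j \<ge> 1" using that by simp
    note [measurable] = X_measurable[OF this]
    have "AE \<omega> in M. X j \<omega> \<in> \<nat>"
      using that by (intro AE_nat_valued X_measurable total_probability) auto
    then show "AE \<omega> in M. norm (exp (d * complex_of_real (X j \<omega>))) \<le> 1"
      by eventually_elim (use \<open>Re d \<le> 0\<close> in \<open>auto simp: mult_nonpos_nonneg elim: Nats_cases\<close>)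
    show "(\<lambda>\<omega>. exp (d * complex_of_real (X j \<omega>))) \<in> borel_measurable M"
      by measurable
  qed
  then have "expectation (\<lambda>\<omega>. \<Prod>j\<in>{1..n}. exp (d * complex_of_real (X j \<omega>)))
      = (\<Prod>j\<in>{1..n}. expectation (\<lambda>\<omega>. exp (d * complex_of_real (X j \<omega>))))"
    by (intro indep_vars_lebesgue_integral indep') auto
  also have "\<dots> = (1 / (1 + csqrt (1 - exp d))) ^ n"
    using \<open>Re d \<le> 0\<close> by (simp add: expectation_exp_X)
  also have "(\<lambda>\<omega>. \<Prod>j\<in>{1..n}. exp (d * complex_of_real (X j \<omega>)))
      = (\<lambda>\<omega>. exp (c * complex_of_real (Y n \<omega>)))"
    by (simp add: exp_sum[symmetric] sum_distrib_left sum_divide_distrib Y_def d_def)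
  finally show ?thesis by (simp add: d_def)
qed

lemma char_\<mu>: "char (\<mu> n) t = expectation (\<lambda>\<omega>. exp (\<i> * complex_of_real t * complex_of_real (Y n \<omega>)))"
  by (simp add: \<mu>_def char_def integral_distr mult.assoc)

lemma char_\<mu>_tendsto: "(\<lambda>n. char (\<mu> n) t) \<longlonglongrightarrow> exp (- csqrt (- (\<i> * complex_of_real t)))"
proof (cases "t = 0")
  \<comment> \<open>Here the limit point would lie on the branch cut of \<open>csqrt\<close>; both
    sides are 1.\<close>
  case True
  then show ?thesis
    by (simp add: real_distribution.char_zero[OF real_distribution_\<mu>])
next
  case False
  define c where "c = \<i> * complex_of_real t"
  have "- c \<notin> \<real>\<^sub>\<le>\<^sub>0"
    using False by (auto simp: c_def complex_nonpos_Reals_iff)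
  then have "(\<lambda>n. (1 / (1 + csqrt (1 - exp (c / (of_nat n)\<^sup>2)))) ^ n) \<longlonglongrightarrow> exp (- csqrt (- c))"
    by (intro tendsto_inverse_one_plus_power tendsto_scaled_csqrt Re_csqrt)
  then show ?thesis
    using expectation_exp_Y[of c] by (simp add: char_\<mu> c_def)
qed

section \<open>Tightness\<close>

text \<open>From \<open>1 - exp (- x) \<le> x\<close> the root \<open>s\<close> is at most
  \<open>sqrt r / n\<close>, and \<open>1 + s \<le> exp s\<close> bounds the \<open>n\<close>-th
  power below by \<open>exp (- (n * s))\<close>.\<close>

lemma expectation_exp_neg_Y_ge:
  assumes "0 \<le> r"
  shows "exp (- sqrt r) \<le> expectation (\<lambda>\<omega>. exp (- r * Y n \<omega>))"
proof (cases "n = 0")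
  case True
  then show ?thesis using assms by (simp add: Y_def prob_space)
next
  case False
  define s where "s = sqrt (1 - exp (- r / (real n)\<^sup>2))"
  have le: "0 \<le> 1 - exp (- r / (real n)\<^sup>2)"
    using assms by simp
  have "complex_of_real (expectation (\<lambda>\<omega>. exp (- r * Y n \<omega>)))
      = expectation (\<lambda>\<omega>. exp (complex_of_real (- r) * complex_of_real (Y n \<omega>)))"
    by (simp flip: integral_complex_of_real exp_of_real)
  also have "\<dots> = (1 / (1 + csqrt (1 - exp (complex_of_real (- r) / (of_nat n)\<^sup>2)))) ^ n"
    using assms by (intro expectation_exp_Y) simp
  also have "1 - exp (complex_of_real (- r) / (of_nat n)\<^sup>2) = complex_of_real (1 - exp (- r / (real n)\<^sup>2))"
    by (simp flip: exp_of_real)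
  also have "csqrt \<dots> = complex_of_real s"
    unfolding s_def by (rule csqrt_of_real[OF le])
  also have "(1 / (1 + complex_of_real s)) ^ n = complex_of_real ((1 / (1 + s)) ^ n)"
    by simp
  finally have E: "expectation (\<lambda>\<omega>. exp (- r * Y n \<omega>)) = (1 / (1 + s)) ^ n"
    unfolding of_real_eq_iff .
  have "0 \<le> s" unfolding s_def using le by simp
  have "s \<le> sqrt (r / (real n)\<^sup>2)"
    unfolding s_def using exp_ge_add_one_self[of "- r / (real n)\<^sup>2"] by (intro real_sqrt_le_mono) simp
  then have "s \<le> sqrt r / real n"
    by (simp add: real_sqrt_divide)
  then have "n * s \<le> sqrt r"
    using False by (simp add: field_simps)
  then have "exp (- sqrt r) \<le> exp (- (n * s))"
    by simp
  also have "\<dots> = exp (- s) ^ n"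
    by (simp flip: exp_of_nat_mult)
  also have "\<dots> \<le> (1 / (1 + s)) ^ n"
    using exp_ge_add_one_self[of s] \<open>0 \<le> s\<close>
    by (intro power_mono) (auto simp: exp_minus field_simps)
  finally show ?thesis
    unfolding E .
qed

text \<open>Markov's inequality at level 1/2 for \<open>u\<close>: the Laplace bound at
  \<open>r = 1 / K\<close> gives \<open>u\<close> mean at most \<open>1 / sqrt K\<close>, and
  \<open>Y n \<omega> > K\<close> forces \<open>u \<omega> \<ge> 1 / 2\<close>. The left endpoint is
  negative so that the half-open interval contains 0.\<close>

lemma measure_\<mu>_ge:
  assumes "0 < K"
  shows "1 - 2 / sqrt K \<le> measure (\<mu> n) {-1<..K}"
proof -
  define u where "u \<omega> = 1 - exp (- (1 / K) * Y n \<omega>)" for \<omega>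
  have AE: "AE \<omega> in M. 0 \<le> u \<omega> \<and> u \<omega> \<le> 1"
    using AE_Y_nonneg[of n] by eventually_elim (use assms in \<open>auto simp: u_def\<close>)
  have int_exp: "integrable M (\<lambda>\<omega>. exp (- (1 / K) * Y n \<omega>))"
    using AE by (intro integrable_const_bound[where B = 1]) (auto simp: u_def elim!: eventually_mono)
  then have int: "integrable M u"
    unfolding u_def by (intro Bochner_Integration.integrable_diff integrable_const)
  have "expectation u = 1 - expectation (\<lambda>\<omega>. exp (- (1 / K) * Y n \<omega>))"
    unfolding u_def using int_exp by (subst Bochner_Integration.integral_diff) (auto simp: prob_space)
  also have "\<dots> \<le> 1 - exp (- sqrt (1 / K))"
    using expectation_exp_neg_Y_ge[of "1 / K" n] assms by simp
  also have "\<dots> \<le> 1 / sqrt K"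
    using exp_ge_add_one_self[of "- sqrt (1 / K)"] by (simp add: real_sqrt_divide)
  finally have Eu: "expectation u \<le> 1 / sqrt K" .
  have "prob {\<omega> \<in> space M. 1 / 2 \<le> u \<omega>} \<le> expectation u / (1 / 2)"
    using AE by (intro integral_Markov_inequality_measure[OF int, of "{}"]) (auto elim!: eventually_mono)
  then have small: "prob {\<omega> \<in> space M. 1 / 2 \<le> u \<omega>} \<le> 2 / sqrt K"
    using Eu by simp
  have [measurable]: "u \<in> borel_measurable M"
    unfolding u_def by measurable
  have "prob (space M - {\<omega> \<in> space M. 1 / 2 \<le> u \<omega>}) \<le> prob {\<omega> \<in> space M. Y n \<omega> \<in> {-1<..K}}"
  proof (rule finite_measure_mono_AE)
    show "AE \<omega> in M. \<omega> \<in> space M - {\<omega> \<in> space M. 1 / 2 \<le> u \<omega>} \<longrightarrow> \<omega> \<in> {\<omega> \<in> space M. Y n \<omega> \<in> {-1<..K}}"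
      using AE_Y_nonneg[of n]
    proof eventually_elim
      fix \<omega> assume nonneg: "0 \<le> Y n \<omega>"
      have "1 / 2 \<le> u \<omega>" if "K < Y n \<omega>"
      proof -
        have "1 < Y n \<omega> / K"
          using that assms by simp
        then have "2 \<le> exp (Y n \<omega> / K)"
          using exp_ge_add_one_self[of "Y n \<omega> / K"] by linarith
        then show ?thesis
          by (simp add: u_def exp_minus field_simps)
      qed
      then show "\<omega> \<in> space M - {\<omega> \<in> space M. 1 / 2 \<le> u \<omega>} \<longrightarrow> \<omega> \<in> {\<omega> \<in> space M. Y n \<omega> \<in> {-1<..K}}"
        using nonneg by fastforce
    qed
  qed measurable
  then have "1 - prob {\<omega> \<in> space M. 1 / 2 \<le> u \<omega>} \<le> prob {\<omega> \<in> space M. Y n \<omega> \<in> {-1<..K}}"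
    by (subst (asm) prob_compl) auto
  moreover have "measure (\<mu> n) {-1<..K} = prob {\<omega> \<in> space M. Y n \<omega> \<in> {-1<..K}}"
    unfolding \<mu>_def by (subst measure_distr) (auto intro!: arg_cong[where f = prob])
  ultimately show ?thesis
    using small by linarith
qed

lemma tight_\<mu>: "tight \<mu>"
  unfolding tight_def
proof (intro conjI allI impI)
  fix \<epsilon> :: real assume "0 < \<epsilon>"
  \<comment> \<open>Chosen so that the loss \<open>2 / sqrt K\<close> is
    \<open>\<epsilon> / 2\<close>, which leaves a strict inequality.\<close>
  define K where "K = (4 / \<epsilon>)\<^sup>2"
  have "0 < K" "2 / sqrt K = \<epsilon> / 2"
    using \<open>0 < \<epsilon>\<close> by (auto simp: K_def real_sqrt_divide)
  then have "1 - \<epsilon> < measure (\<mu> n) {-1<..K}" for n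
    using measure_\<mu>_ge[of K n] \<open>0 < \<epsilon>\<close> by linarith
  then show "\<exists>a b. a < b \<and> (\<forall>n. 1 - \<epsilon> < measure (\<mu> n) {a<..b})"
    using \<open>0 < K\<close> by (intro exI[of _ "-1"] exI[of _ K]) auto
qed (rule real_distribution_\<mu>)

section \<open>Existence and support of the limit law\<close>

lemma weak_limit:
  obtains \<nu> where "real_distribution \<nu>" "weak_conv_m \<mu> \<nu>"
    "\<And>t. char \<nu> t = exp (- csqrt (- (\<i> * complex_of_real t)))" "AE x in \<nu>. 0 \<le> x"
proof -
  obtain r \<nu> where r: "strict_mono (r :: nat \<Rightarrow> nat)" "real_distribution \<nu>" "weak_conv_m (\<mu> \<circ> r) \<nu>"
    using tight_imp_convergent_subsubsequence[OF tight_\<mu> strict_mono_id] by (auto simp: comp_def)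
  interpret \<nu>: real_distribution \<nu> by fact
  have char: "char \<nu> t = exp (- csqrt (- (\<i> * complex_of_real t)))" for t
  proof (rule LIMSEQ_unique)
    show "(\<lambda>n. char ((\<mu> \<circ> r) n) t) \<longlonglongrightarrow> char \<nu> t"
      by (rule levy_continuity1[OF _ r(2,3)]) (simp add: real_distribution_\<mu>)
    show "(\<lambda>n. char ((\<mu> \<circ> r) n) t) \<longlonglongrightarrow> exp (- csqrt (- (\<i> * complex_of_real t)))"
      using LIMSEQ_subseq_LIMSEQ[OF char_\<mu>_tendsto r(1)] by (simp add: comp_def)
  qed
  have conv: "weak_conv_m \<mu> \<nu>"
    using char_\<mu>_tendsto by (intro levy_continuity real_distribution_\<mu> r(2)) (simp add: char)
  \<comment> \<open>A bounded continuous test function, positive exactly on the negative reals. Its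
    integral against every \<open>\<mu> n\<close> is 0, hence also against
    \<open>\<nu>\<close>.\<close>
  define f where "f x = max 0 (min 1 (- x))" for x :: real
  have f: "isCont f x" "norm (f x) \<le> 1" "0 \<le> f x" for x
    unfolding f_def by (auto intro!: continuous_intros)
  have [measurable]: "f \<in> borel_measurable borel"
    unfolding f_def by measurable
  have "(\<lambda>n. integral\<^sup>L (\<mu> n) f) \<longlonglongrightarrow> integral\<^sup>L \<nu> f"
    by (rule weak_conv_imp_integral_bdd_continuous_conv[OF real_distribution_\<mu> r(2) conv f(1,2)])
  moreover have "integral\<^sup>L (\<mu> n) f = 0" for n
  proof -
    have "integral\<^sup>L (\<mu> n) f = expectation (\<lambda>\<omega>. f (Y n \<omega>))"
      unfolding \<mu>_def by (rule integral_distr) auto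
    also have "\<dots> = expectation (\<lambda>\<omega>. 0)"
      using AE_Y_nonneg[of n] by (intro integral_cong_AE) (auto simp: f_def elim!: eventually_mono)
    finally show ?thesis by simp
  qed
  ultimately have "integral\<^sup>L \<nu> f = 0"
    by (simp add: LIMSEQ_const_iff)
  moreover have "integrable \<nu> f"
    by (rule \<nu>.integrable_const_bound[where B = 1]) (use f in auto)
  ultimately have "AE x in \<nu>. f x = 0"
    using integral_nonneg_eq_0_iff_AE[of \<nu> f] f(3) by simp
  then have "AE x in \<nu>. 0 \<le> x"
    by eventually_elim (auto simp: f_def split: if_splits)
  with r(2) conv char show ?thesis by (rule that)
qed

end

section \<open>Stability of the limit law\<close>

text \<open>Fubini on the product measure: the exponential splits into one factor for each
  coordinate.\<close>

lemma (in real_distribution) char_linear_combination: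
  "char (distr (M \<Otimes>\<^sub>M M) borel (\<lambda>(x, y). a * x + b * y)) t = char M (t * a) * char M (t * b)"
proof -
  interpret P: pair_prob_space M M ..
  have "char (distr (M \<Otimes>\<^sub>M M) borel (\<lambda>(x, y). a * x + b * y)) t
      = (CLINT z|M \<Otimes>\<^sub>M M. iexp (t * a * fst z) * iexp (t * b * snd z))"
    unfolding char_def
    by (subst integral_distr) (auto simp: split_beta' algebra_simps exp_add[symmetric] intro!: Bochner_Integration.integral_cong)
  also have "\<dots> = (CLINT x|M. CLINT y|M. iexp (t * a * x) * iexp (t * b * y))"
    by (subst P.integral_fst'[symmetric])
       (auto intro!: P.P.integrable_const_bound[where B = 1] simp: norm_mult simp del: of_real_mult)
  also have "\<dots> = char M (t * a) * char M (t * b)"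
    by (simp add: char_def mult.assoc del: of_real_mult)
  finally show ?thesis .
qed

text \<open>Scaling the argument by \<open>s\<close> multiplies the root by \<open>sqrt s\<close>,
  so the exponents for \<open>a\<close> and \<open>b\<close> add up to the one for \<open>c\<close>;
  characteristic functions determine the law.\<close>

lemma stable_distribution_half:
  assumes "real_distribution \<nu>"
    and char: "\<And>t. char \<nu> t = exp (- csqrt (- (\<i> * complex_of_real t)))"
  shows "stable_distribution (1 / 2) \<nu>"
proof -
  interpret real_distribution \<nu> by fact
  have "\<not> (AE x in \<nu>. x = c)" for c
  proof
    assume "AE x in \<nu>. x = c"
    \<comment> \<open>A point mass would have a characteristic function of modulus 1. At 2 the root
      is \<open>1 - \<i>\<close>, so the modulus is \<open>exp (-1)\<close>.\<close>
    then have "char \<nu> 2 = (CLINT x|\<nu>. iexp (2 * c))"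
      unfolding char_def by (intro integral_cong_AE) (auto elim!: eventually_mono)
    then have "norm (char \<nu> 2) = 1"
      by (simp add: prob_space[unfolded space_eq_univ])
    moreover have "csqrt (- (\<i> * complex_of_real 2)) = 1 - \<i>"
      by (rule csqrt_unique) (auto simp: power2_eq_square complex_eq_iff)
    then have "norm (char \<nu> 2) = exp (-1)"
      by (simp add: char)
    ultimately show False by simp
  qed
  moreover have "\<exists>c>0. \<exists>d. c powr (1 / 2) = a powr (1 / 2) + b powr (1 / 2) \<and>
        distr (\<nu> \<Otimes>\<^sub>M \<nu>) borel (\<lambda>(x, y). a * x + b * y) = distr \<nu> borel (\<lambda>x. c * x + d)"
    if "0 < a" "0 < b" for a b
  proof (intro exI conjI)
    define c where "c = (sqrt a + sqrt b)\<^sup>2"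
    interpret P: pair_prob_space \<nu> \<nu> ..
    have sqrt_c: "sqrt c = sqrt a + sqrt b" and "0 < c"
      using that by (auto simp: c_def add_nonneg_nonneg add_pos_pos less_imp_neq[OF add_pos_pos, THEN not_sym])
    then show "0 < c" "c powr (1 / 2) = a powr (1 / 2) + b powr (1 / 2)"
      using that by (auto simp: powr_half_sqrt)
    have scale: "csqrt (- (\<i> * complex_of_real (t * s))) = complex_of_real (sqrt s) * csqrt (- (\<i> * complex_of_real t))"
      if "0 < s" for s t
      using csqrt_of_real_mult[of s "- (\<i> * complex_of_real t)"] that by (simp add: mult_ac)
    \<comment> \<open>The explicit \<open>+ 0\<close> instantiates the shift \<open>d\<close>, left
      open so far.\<close>
    show "distr (\<nu> \<Otimes>\<^sub>M \<nu>) borel (\<lambda>(x, y). a * x + b * y) = distr \<nu> borel (\<lambda>x. c * x + 0)"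
    proof (rule Levy_uniqueness)
      show "real_distribution (distr (\<nu> \<Otimes>\<^sub>M \<nu>) borel (\<lambda>(x, y). a * x + b * y))"
        by (rule P.P.real_distribution_distr) (simp add: split_beta')
      show "real_distribution (distr \<nu> borel (\<lambda>x. c * x + 0))"
        by (rule real_distribution_distr) simp
      show "char (distr (\<nu> \<Otimes>\<^sub>M \<nu>) borel (\<lambda>(x, y). a * x + b * y)) = char (distr \<nu> borel (\<lambda>x. c * x + 0))"
      proof
        fix t
        have "char (distr \<nu> borel (\<lambda>x. c * x + 0)) t = char \<nu> (t * c)"
          unfolding char_def by (subst integral_distr) (auto simp: mult_ac)
        then show "char (distr (\<nu> \<Otimes>\<^sub>M \<nu>) borel (\<lambda>(x, y). a * x + b * y)) t
            = char (distr \<nu> borel (\<lambda>x. c * x + 0)) t"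
          unfolding char_linear_combination
          by (simp only: char scale[OF \<open>0 < a\<close>] scale[OF \<open>0 < b\<close>] scale[OF \<open>0 < c\<close>] sqrt_c
              of_real_add distrib_right minus_add_distrib exp_add)
      qed
    qed
  qed
  ultimately show ?thesis
    using assms(1) by (auto simp: stable_distribution_def)
qed

theorem proposition3:
  fixes M :: "'a measure" and X :: "nat \<Rightarrow> 'a \<Rightarrow> real"
  assumes "prob_space M"
    and "prob_space.indep_vars M (\<lambda>_. borel) X {1..}"
    and "\<And>n k. n \<ge> 1 \<Longrightarrow>
           measure M {\<omega> \<in> space M. X n \<omega> = real k} = catalan k / (2 * 4 ^ k)"
  shows "\<exists>\<mu>. one_sided_stable (1 / 2) \<mu> \<and>
     (\<forall>t. char_neg \<mu> t =
        exp (- complex_of_real (sqrt 2 / 2) * complex_of_real (\<bar>t\<bar> powr (1 / 2))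
             * (1 + \<i> * complex_of_real (sgn t)))) \<and>
     weak_conv_m (\<lambda>n. distr M borel (\<lambda>\<omega>. (\<Sum>j=1..n. X j \<omega>) / (real n)\<^sup>2)) \<mu>"
proof -
  interpret iid_catalan M X
    by (intro iid_catalan.intro iid_catalan_axioms.intro assms)
  obtain \<nu> where \<nu>: "real_distribution \<nu>" "weak_conv_m \<mu> \<nu>"
    "\<And>t. char \<nu> t = exp (- csqrt (- (\<i> * complex_of_real t)))" "AE x in \<nu>. 0 \<le> x"
    by (rule weak_limit) (rule that)
  have "one_sided_stable (1 / 2) \<nu>"
    unfolding one_sided_stable_def using \<nu> by (auto intro: stable_distribution_half)
  moreover have "char_neg \<nu> t = exp (- complex_of_real (sqrt 2 / 2)
      * complex_of_real (\<bar>t\<bar> powr (1 / 2)) * (1 + \<i> * complex_of_real (sgn t)))" for t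
    \<comment> \<open>The sign convention replaces \<open>t\<close> by \<open>- t\<close>, so the
      root is that of \<open>\<i> * t\<close>.\<close>
    unfolding char_neg_eq_char \<nu>(3) by (simp add: csqrt_imaginary)
  moreover have "\<mu> = (\<lambda>n. distr M borel (\<lambda>\<omega>. (\<Sum>j=1..n. X j \<omega>) / (real n)\<^sup>2))"
    by (simp add: fun_eq_iff \<mu>_def Y_def[abs_def])
  ultimately show ?thesis
    using \<nu>(2) by metis
qed

end
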